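(* Let $X$ be a Banach function space, and let $\phi:\{1,2,3,\ldots\}\to[0,+\infty)$ be a function with $\lim_{K\to\infty}\phi(K)/K=0$ such that $$\Big\|\sup_{n=1,\ldots,N}|f_n|\Big\|_X\le\phi(N)$$ whenever $N\in\{1,2,\ldots\}$ and $f_1,\ldots,f_N\in X$ are pairwise disjointly supported with $\max_{n=1,\ldots,N}\|f_n\|_X\le1$. Let $(F_i)_{i=1}^\infty$ be a sequence of nonempty sets $F_i\subset X$ such that $$\sup_i\ \sup_{f_i\in F_i}\|f_i\|_X<+\infty.$$ Then either of the following conditions is sufficient for the sequence $(F_i)$ to be admissible for testing compactness: (1) For each fixed $f\in\bigcup_iF_i$ and for every sequence $(f_i)$ with $f_i\in F_i$ for all $i$, we have $\lim_{i\to\infty}\|1_{\operatorname{supp}f}\,f_i\|_X=0$. (2) For each fixed $f\in\bigcup_iF_i$ and for every sequence $(f_i)$ with $f_i\in F_i$ for all $i$, we have $\lim_{i\to\infty}\|1_{\operatorname{supp}(f_i)}\,f\|_X=0$.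
   Context: A Banach function space is a Banach space $X$ of ($\mu$-a.e. equivalence classes of) scalar-valued measurable functions on a measure space $(\Omega,\mu)$ with the ideal (lattice) property: if $g\in X$, $f$ is measurable and $|f|\le|g|$ $\mu$-a.e., then $f\in X$ and $\|f\|_X\le\|g\|_X$. For a measurable function $f$, $\operatorname{supp}f=\{f\neq0\}$ (defined up to null sets), and functions are pairwise disjointly supported if their supports are pairwise disjoint (up to null sets). A sequence $(F_i)$ of sets in $X$ is called admissible for testing compactness if $\limsup_{i\to\infty}\sup_{f_i\in F_i}\|Tf_i\|_Y=0$ for every Banach space $Y$ (over the same scalar field) and every compact linear operator $T:X\to Y$. *)

theory Defs
  imports "HOL-Analysis.Analysis"
begin

text \<open>
  Scalars range over a type \<open>'k :: {real_normed_field, euclidean_space}\<close>. The instances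
  \<open>real\<close> and \<open>complex\<close> are, up to isometric isomorphism, the only possible ones (Frobenius),
  so this covers exactly the real and the complex case.

  A space of almost-everywhere equivalence classes is represented by the set \<open>X\<close> of all
  representatives of its elements, with \<open>N f\<close> the norm of the class of \<open>f\<close>. The axiom
  \<open>ideal\<close> makes \<open>X\<close> and \<open>N\<close> invariant under a.e. equality, and \<open>norm_eq_0\<close> makes \<open>N\<close> a
  genuine norm on classes. The values of \<open>N\<close> outside \<open>X\<close> are irrelevant.
\<close>

locale banach_function_space =
  fixes M :: "'a measure"
    and X :: "('a \<Rightarrow> 'k::{real_normed_field, euclidean_space}) set"
    and N :: "('a \<Rightarrow> 'k) \<Rightarrow> real"
  assumes measurable: "X \<subseteq> borel_measurable M"
    and zero_mem: "(\<lambda>x. 0) \<in> X"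
    and add_mem: "\<lbrakk>f \<in> X; g \<in> X\<rbrakk> \<Longrightarrow> (\<lambda>x. f x + g x) \<in> X"
    and scale_mem: "f \<in> X \<Longrightarrow> (\<lambda>x. c * f x) \<in> X"
    and norm_nonneg: "f \<in> X \<Longrightarrow> 0 \<le> N f"
    and norm_eq_0: "f \<in> X \<Longrightarrow> N f = 0 \<longleftrightarrow> (AE x in M. f x = 0)"
    and norm_triangle: "\<lbrakk>f \<in> X; g \<in> X\<rbrakk> \<Longrightarrow> N (\<lambda>x. f x + g x) \<le> N f + N g"
    and norm_scale: "f \<in> X \<Longrightarrow> N (\<lambda>x. c * f x) = norm c * N f"
    and complete: "\<lbrakk>\<And>n. u n \<in> X;
          \<And>e. 0 < e \<Longrightarrow> \<exists>K. \<forall>m\<ge>K. \<forall>n\<ge>K. N (\<lambda>x. u m x - u n x) < e\<rbrakk>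
        \<Longrightarrow> \<exists>g\<in>X. (\<lambda>n. N (\<lambda>x. u n x - g x)) \<longlonglongrightarrow> 0"
    and ideal: "\<lbrakk>g \<in> X; f \<in> borel_measurable M; AE x in M. norm (f x) \<le> norm (g x)\<rbrakk>
        \<Longrightarrow> f \<in> X \<and> N f \<le> N g"

definition supp :: "'a measure \<Rightarrow> ('a \<Rightarrow> 'k::zero) \<Rightarrow> 'a set" where
  "supp M f = {x \<in> space M. f x \<noteq> 0}"

definition disjointly_supported :: "'a measure \<Rightarrow> ('a \<Rightarrow> 'k::zero) \<Rightarrow> ('a \<Rightarrow> 'k) \<Rightarrow> bool" where
  "disjointly_supported M f g \<longleftrightarrow> supp M f \<inter> supp M g \<in> null_sets M"

text \<open>
  A Banach space over \<open>'k\<close> is a type \<open>'y :: banach\<close> with a compatible scalar multiplication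
  by \<open>'k\<close> that extends the one by reals.
\<close>

definition banach_scaling :: "('k::real_normed_field \<Rightarrow> 'y::banach \<Rightarrow> 'y) \<Rightarrow> bool" where
  "banach_scaling sc \<longleftrightarrow> vector_space sc \<and>
     (\<forall>c y. norm (sc c y) = norm c * norm y) \<and>
     (\<forall>r y. sc (of_real r) y = r *\<^sub>R y)"

text \<open>
  The second conjunct says that \<open>T\<close> is well defined on equivalence classes.
  The values of \<open>T\<close> outside \<open>X\<close> are irrelevant.
\<close>

definition linear_operator ::
  "'a measure \<Rightarrow> ('a \<Rightarrow> 'k::{real_normed_field, euclidean_space}) set \<Rightarrow>
   ('k \<Rightarrow> 'y::banach \<Rightarrow> 'y) \<Rightarrow> (('a \<Rightarrow> 'k) \<Rightarrow> 'y) \<Rightarrow> bool" where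
  "linear_operator M X sc T \<longleftrightarrow>
     (\<forall>f\<in>X. \<forall>g\<in>X. T (\<lambda>x. f x + g x) = T f + T g) \<and>
     (\<forall>f\<in>X. \<forall>g\<in>X. (AE x in M. f x = g x) \<longrightarrow> T f = T g) \<and>
     (\<forall>c. \<forall>f\<in>X. T (\<lambda>x. c * f x) = sc c (T f))"

definition compact_operator ::
  "'a measure \<Rightarrow> ('a \<Rightarrow> 'k::{real_normed_field, euclidean_space}) set \<Rightarrow>
   (('a \<Rightarrow> 'k) \<Rightarrow> real) \<Rightarrow> ('k \<Rightarrow> 'y::banach \<Rightarrow> 'y) \<Rightarrow> (('a \<Rightarrow> 'k) \<Rightarrow> 'y) \<Rightarrow> bool" where
  "compact_operator M X N sc T \<longleftrightarrow>
     linear_operator M X sc T \<and> compact (closure (T ` {f \<in> X. N f \<le> 1}))"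

text \<open>
  HOL cannot quantify over types inside a formula, so the type of \<open>Y\<close> is a parameter;
  a theorem concluding this for a type variable \<open>'y\<close> asserts it for all Banach spaces.
\<close>

definition admissible_testing_compactness ::
  "'a measure \<Rightarrow> ('a \<Rightarrow> 'k::{real_normed_field, euclidean_space}) set \<Rightarrow>
   (('a \<Rightarrow> 'k) \<Rightarrow> real) \<Rightarrow> (nat \<Rightarrow> ('a \<Rightarrow> 'k) set) \<Rightarrow> 'y::banach itself \<Rightarrow> bool" where
  "admissible_testing_compactness M X N F Y \<longleftrightarrow>
     (\<forall>(sc :: 'k \<Rightarrow> 'y \<Rightarrow> 'y) T. banach_scaling sc \<longrightarrow> compact_operator M X N sc T \<longrightarrow>
        limsup (\<lambda>i. SUP f\<in>F i. ereal (norm (T f))) = 0)"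

end

theory Submission imports Defs begin

text \<open>
  If the conclusion fails, compactness gives functions \<open>u k\<close> taken from infinitely many of the
  \<open>F i\<close> such that \<open>T (u k)\<close> converges to a nonzero \<open>y\<close>. Among them one finds, for every \<open>K\<close>,
  \<open>K\<close> functions that are disjointly supported up to an arbitrarily small error: in case (1) each
  one is cut off outside the supports of its predecessors, in case (2) outside those of its
  successors. Their sum has norm at most \<open>C * \<phi> K\<close> up to the error, while its image under \<open>T\<close> is
  close to \<open>K * y\<close>. This contradicts \<open>\<phi> K / K \<longlonglongrightarrow> 0\<close>.
\<close>

section \<open>Finite sums and restrictions to measurable sets\<close>

context banach_function_space
begin

lemma sum_mem:
  assumes "finite I" "\<And>i. i \<in> I \<Longrightarrow> h i \<in> X"
  shows "(\<lambda>x. \<Sum>i\<in>I. h i x) \<in> X"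
  using assms by (induction I rule: finite_induct) (simp_all add: zero_mem add_mem)

lemma norm_zero: "N (\<lambda>x. 0) = 0"
  using norm_eq_0[OF zero_mem] by simp

lemma norm_scale_of_real: "f \<in> X \<Longrightarrow> N (\<lambda>x. of_real r * f x) = \<bar>r\<bar> * N f"
  by (simp add: norm_scale)

lemma norm_sum:
  assumes "finite I" "\<And>i. i \<in> I \<Longrightarrow> h i \<in> X"
  shows "N (\<lambda>x. \<Sum>i\<in>I. h i x) \<le> (\<Sum>i\<in>I. N (h i))"
  using assms
proof (induction I rule: finite_induct)
  case empty
  then show ?case by (simp add: norm_zero)
next
  case (insert i I)
  then have "N (\<lambda>x. h i x + (\<Sum>i\<in>I. h i x)) \<le> N (h i) + N (\<lambda>x. \<Sum>i\<in>I. h i x)"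
    by (intro norm_triangle sum_mem) auto
  with insert show ?case by simp
qed

lemma supp_measurable: "f \<in> X \<Longrightarrow> supp M f \<in> sets M"
  using measurable unfolding supp_def by (auto intro!: measurable_sets)

lemma restrict_mem_norm_le:
  assumes "f \<in> X" "A \<in> sets M"
  shows "(\<lambda>x. indicator A x * f x) \<in> X \<and> N (\<lambda>x. indicator A x * f x) \<le> N f"
proof (rule ideal[OF assms(1)])
  have "f \<in> borel_measurable M" using assms(1) measurable by blast
  then show "(\<lambda>x. indicator A x * f x) \<in> borel_measurable M"
    using assms(2) by measurable
qed (auto simp: indicator_def)

text \<open>The indicator of a union is at most the sum of the indicators, and the ideal property
  with the triangle inequality turns this into a norm bound. It controls the part of a function that
  is cut off along several supports at once.\<close>

lemma restrict_Union_norm_le: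
  assumes "finite I" "\<And>i. i \<in> I \<Longrightarrow> A i \<in> sets M" "f \<in> X"
  shows "N (\<lambda>x. indicator (\<Union>i\<in>I. A i) x * f x) \<le> (\<Sum>i\<in>I. N (\<lambda>x. indicator (A i) x * f x))"
  using assms(1,2)
proof (induction I rule: finite_induct)
  case empty
  then show ?case by (simp add: norm_zero)
next
  case (insert i I)
  let ?B = "\<Union>i\<in>I. A i"
  have B: "?B \<in> sets M" using insert by auto
  \<comment> \<open>Removing \<open>A i\<close> from the remaining union makes the two pieces
    disjoint, so the pointwise comparison is an equality.\<close>
  have "N (\<lambda>x. indicator (\<Union>i\<in>insert i I. A i) x * f x)
    \<le> N (\<lambda>x. indicator (A i) x * f x + indicator (?B - A i) x * f x)"
  proof (rule ideal[THEN conjunct2])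
    show "(\<lambda>x. indicator (A i) x * f x + indicator (?B - A i) x * f x) \<in> X"
      using restrict_mem_norm_le[OF assms(3)] B insert by (intro add_mem) auto
    show "(\<lambda>x. indicator (\<Union>i\<in>insert i I. A i) x * f x) \<in> borel_measurable M"
      using restrict_mem_norm_le[OF assms(3), of "\<Union>i\<in>insert i I. A i"] insert B measurable by auto
  qed (auto simp: indicator_def)
  also have "\<dots> \<le> N (\<lambda>x. indicator (A i) x * f x) + N (\<lambda>x. indicator (?B - A i) x * f x)"
    using restrict_mem_norm_le[OF assms(3)] B insert by (intro norm_triangle) auto
  also have "N (\<lambda>x. indicator (?B - A i) x * f x) \<le> N (\<lambda>x. indicator ?B x * f x)"
  proof (rule ideal[THEN conjunct2])
    show "(\<lambda>x. indicator ?B x * f x) \<in> X"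
      using restrict_mem_norm_le[OF assms(3) B] by simp
    show "(\<lambda>x. indicator (?B - A i) x * f x) \<in> borel_measurable M"
      using restrict_mem_norm_le[OF assms(3), of "?B - A i"] insert B measurable by auto
  qed (auto simp: indicator_def)
  also have "\<dots> \<le> (\<Sum>i\<in>I. N (\<lambda>x. indicator (A i) x * f x))"
    using insert by auto
  finally show ?case using insert by simp
qed

section \<open>Sums of functions with disjoint or almost disjoint supports\<close>

lemma norm_disjoint_sum_eq_Max:
  assumes dis: "\<And>j k. \<lbrakk>j \<in> {1..n}; k \<in> {1..n}; j \<noteq> k\<rbrakk> \<Longrightarrow> supp M (h j) \<inter> supp M (h k) = {}"
    and n: "1 \<le> n" and x: "x \<in> space M"
  shows "norm (\<Sum>j\<in>{1..n}. h j x) = (MAX j\<in>{1..n::nat}. norm (h j x))"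
\<comment> \<open>By disjointness at most one summand is nonzero at \<open>x\<close>, and it is then
  both the sum and the term of maximal norm.\<close>
proof (cases "\<exists>k\<in>{1..n}. h k x \<noteq> 0")
  case True
  then obtain k where k: "k \<in> {1..n}" "h k x \<noteq> 0" by blast
  have z: "h j x = 0" if "j \<in> {1..n}" "j \<noteq> k" for j
    using dis[OF that(1) k(1) that(2)] k x by (auto simp: supp_def)
  have "(\<Sum>j\<in>{1..n}. h j x) = h k x"
    using sum.remove[OF _ k(1), of "\<lambda>j. h j x"] z by simp
  moreover have "(MAX j\<in>{1..n}. norm (h j x)) = norm (h k x)"
  proof (rule Max_eqI)
    fix y assume "y \<in> (\<lambda>j. norm (h j x)) ` {1..n}"
    then obtain j where "j \<in> {1..n}" "y = norm (h j x)" by blast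
    then show "y \<le> norm (h k x)" using z[of j] by (cases "j = k") auto
  qed (use k in auto)
  ultimately show ?thesis by simp
next
  case False
  moreover from False have "(\<lambda>j. norm (h j x)) ` {1..n} = {0}"
    using n by force
  ultimately show ?thesis by simp
qed

text \<open>Each \<open>h k\<close> splits into \<open>g k\<close>, cut off outside the supports of
  all \<open>h j\<close> with \<open>R j k\<close>, and an error \<open>e k\<close>. The
  \<open>g k\<close> are disjointly supported, so \<open>upper\<close> bounds their sum; each
  \<open>e k\<close> consists of at most \<open>n\<close> pieces of norm at most \<open>d\<close>.
  The relation \<open>R\<close> is left open so that \<open><\<close> serves condition (1) and
  \<open>>\<close> serves condition (2).\<close>

lemma almost_disjoint_sum_norm_le:
  fixes R :: "nat \<Rightarrow> nat \<Rightarrow> bool"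
  assumes upper: "\<And>(n::nat) (f :: nat \<Rightarrow> 'a \<Rightarrow> 'k).
           \<lbrakk>1 \<le> n; \<And>j. j \<in> {1..n} \<Longrightarrow> f j \<in> X;
            \<And>j k. \<lbrakk>j \<in> {1..n}; k \<in> {1..n}; j \<noteq> k\<rbrakk> \<Longrightarrow> disjointly_supported M (f j) (f k);
            (MAX j\<in>{1..n}. N (f j)) \<le> 1\<rbrakk>
           \<Longrightarrow> N (\<lambda>x. of_real (MAX j\<in>{1..n}. norm (f j x))) \<le> \<phi> n"
    and n: "1 \<le> n" and C: "0 < C" and d: "0 \<le> d"
    and h: "\<And>j. j \<in> {1..n} \<Longrightarrow> h j \<in> X" "\<And>j. j \<in> {1..n} \<Longrightarrow> N (h j) \<le> C"
    and total: "\<And>j k. j \<noteq> k \<Longrightarrow> R j k \<or> R k j"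
    and small: "\<And>j k. \<lbrakk>j \<in> {1..n}; k \<in> {1..n}; R j k\<rbrakk>
                  \<Longrightarrow> N (\<lambda>x. indicator (supp M (h j)) x * h k x) \<le> d"
  shows "N (\<lambda>x. \<Sum>j\<in>{1..n}. h j x) \<le> C * \<phi> n + real n * real n * d"
proof -
  define U where "U k = (\<Union>j\<in>{j\<in>{1..n}. R j k}. supp M (h j))" for k
  define g where "g k = (\<lambda>x. indicator (space M - U k) x * h k x)" for k
  define e where "e k = (\<lambda>x. indicator (U k) x * h k x)" for k
  \<comment> \<open>The factor \<open>1 / C\<close> brings the norms below 1, as
    \<open>upper\<close> requires.\<close>
  define f where "f k = (\<lambda>x. of_real (1 / C) * g k x)" for k
  have U: "U k \<in> sets M" for k
    unfolding U_def using supp_measurable h by (intro sets.finite_UN) auto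
  have e: "e k \<in> X" if "k \<in> {1..n}" for k
    unfolding e_def using restrict_mem_norm_le[OF h(1)[OF that] U] by simp
  have g: "g k \<in> X \<and> N (g k) \<le> C" if "k \<in> {1..n}" for k
    unfolding g_def
    using restrict_mem_norm_le[OF h(1)[OF that], of "space M - U k"] U[of k] h(2)[OF that] by auto
  have f: "f k \<in> X" if "k \<in> {1..n}" for k
    unfolding f_def using scale_mem g that by blast
  have Nf: "N (f k) \<le> 1" if "k \<in> {1..n}" for k
    using g[OF that] C unfolding f_def by (subst norm_scale_of_real) auto
  have dis: "supp M (f j) \<inter> supp M (f k) = {}"
    if "j \<in> {1..n}" "k \<in> {1..n}" "j \<noteq> k" for j k
  proof -
    have "supp M (f k) \<subseteq> supp M (h k) - U k" for k
      by (auto simp: supp_def f_def g_def indicator_def)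
    \<comment> \<open>Whichever way \<open>R\<close> relates \<open>j\<close> and \<open>k\<close>,
      one of the two functions has been cut off on the whole support of the other.\<close>
    moreover have "supp M (h j) \<subseteq> U k \<or> supp M (h k) \<subseteq> U j"
      using total[OF that(3)] that(1,2) unfolding U_def by blast
    ultimately show ?thesis by blast
  qed
  have F: "(\<lambda>x. \<Sum>j\<in>{1..n}. f j x) \<in> X" by (intro sum_mem f) auto
  \<comment> \<open>On \<open>space M\<close> the maximum is the norm of the sum. Hence the maximum
    inherits measurability and membership in \<open>X\<close> from the sum, and the ideal property
    then bounds the norm of the sum by that of the maximum.\<close>
  have m: "of_real (MAX j\<in>{1..n}. norm (f j x)) = (of_real (norm (\<Sum>j\<in>{1..n}. f j x)) :: 'k)"
    if "x \<in> space M" for x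
    using norm_disjoint_sum_eq_Max[of n f, OF dis n that] by simp
  have "(\<lambda>x. of_real (MAX j\<in>{1..n}. norm (f j x)) :: 'k) \<in> borel_measurable M
    \<longleftrightarrow> (\<lambda>x. of_real (norm (\<Sum>j\<in>{1..n}. f j x)) :: 'k) \<in> borel_measurable M"
    by (rule measurable_cong) (rule m)
  moreover have "(\<lambda>x. \<Sum>j\<in>{1..n}. f j x) \<in> borel_measurable M"
    using F measurable by blast
  ultimately have "(\<lambda>x. of_real (MAX j\<in>{1..n}. norm (f j x)) :: 'k) \<in> borel_measurable M"
    by (simp add: borel_measurable_of_real)
  then have Max: "(\<lambda>x. of_real (MAX j\<in>{1..n}. norm (f j x)) :: 'k) \<in> X"
    using ideal[OF F] m by force
  have "N (\<lambda>x. \<Sum>j\<in>{1..n}. f j x) \<le> N (\<lambda>x. of_real (MAX j\<in>{1..n}. norm (f j x)))"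
    using ideal[OF Max, of "\<lambda>x. \<Sum>j\<in>{1..n}. f j x"] F measurable m by force
  also have "\<dots> \<le> \<phi> n"
    using n f dis Nf by (intro upper) (auto simp: disjointly_supported_def)
  finally have 1: "N (\<lambda>x. \<Sum>j\<in>{1..n}. f j x) \<le> \<phi> n" .
  have "(\<lambda>x. \<Sum>j\<in>{1..n}. g j x) = (\<lambda>x. of_real C * (\<Sum>j\<in>{1..n}. f j x))"
    using C by (simp add: f_def sum_distrib_left flip: of_real_mult mult.assoc)
  then have 2: "N (\<lambda>x. \<Sum>j\<in>{1..n}. g j x) \<le> C * \<phi> n"
    using norm_scale[OF F, of "of_real C"] 1 C by simp
  have "N (e k) \<le> real n * d" if k: "k \<in> {1..n}" for k
  proof -
    have "N (e k) \<le> (\<Sum>j\<in>{j\<in>{1..n}. R j k}. N (\<lambda>x. indicator (supp M (h j)) x * h k x))"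
      unfolding e_def U_def using supp_measurable h k by (intro restrict_Union_norm_le) auto
    also have "\<dots> \<le> real (card {j\<in>{1..n}. R j k}) * d"
      using small k by (intro sum_bounded_above) auto
    also have "card {j\<in>{1..n}. R j k} \<le> card {1..n}"
      by (intro card_mono) auto
    then have "real (card {j\<in>{1..n}. R j k}) * d \<le> real n * d"
      using d by (intro mult_right_mono) auto
    finally show ?thesis .
  qed
  then have "(\<Sum>k\<in>{1..n}. N (e k)) \<le> real n * (real n * d)"
    using sum_bounded_above[of "{1..n}" "\<lambda>k. N (e k)" "real n * d"] by simp
  then have 3: "N (\<lambda>x. \<Sum>k\<in>{1..n}. e k x) \<le> real n * (real n * d)"
    using norm_sum[of "{1..n}" e] e by simp
  \<comment> \<open>The decomposition is an identity on \<open>space M\<close> only, since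
    \<open>g k\<close> and \<open>e k\<close> vanish outside it; the ideal property bridges the
    gap.\<close>
  have "N (\<lambda>x. \<Sum>j\<in>{1..n}. h j x) \<le> N (\<lambda>x. (\<Sum>j\<in>{1..n}. g j x) + (\<Sum>k\<in>{1..n}. e k x))"
  proof (rule ideal[THEN conjunct2])
    show "(\<lambda>x. (\<Sum>j\<in>{1..n}. g j x) + (\<Sum>k\<in>{1..n}. e k x)) \<in> X"
      using g e by (intro add_mem sum_mem) auto
    show "(\<lambda>x. \<Sum>j\<in>{1..n}. h j x) \<in> borel_measurable M"
      using sum_mem[of "{1..n}" h] h(1) measurable by auto
    have "(\<Sum>j\<in>{1..n}. h j x) = (\<Sum>j\<in>{1..n}. g j x) + (\<Sum>k\<in>{1..n}. e k x)"
      if "x \<in> space M" for x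
      unfolding sum.distrib[symmetric] using that
      by (intro sum.cong) (auto simp: g_def e_def indicator_def)
    then show "AE x in M. norm (\<Sum>j\<in>{1..n}. h j x)
        \<le> norm ((\<Sum>j\<in>{1..n}. g j x) + (\<Sum>k\<in>{1..n}. e k x))"
      by auto
  qed
  also have "\<dots> \<le> N (\<lambda>x. \<Sum>j\<in>{1..n}. g j x) + N (\<lambda>x. \<Sum>k\<in>{1..n}. e k x)"
    using g e by (intro norm_triangle sum_mem) auto
  finally show ?thesis using 2 3 by simp
qed

section \<open>Linear and compact operators on \<open>X\<close>\<close>

lemma linear_operatorD:
  assumes "linear_operator M X sc T" "f \<in> X"
  shows linear_operator_add: "g \<in> X \<Longrightarrow> T (\<lambda>x. f x + g x) = T f + T g"
    and linear_operator_cong_AE: "g \<in> X \<Longrightarrow> AE x in M. f x = g x \<Longrightarrow> T f = T g"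
    and linear_operator_scale: "T (\<lambda>x. c * f x) = sc c (T f)"
proof -
  note T = assms(1)[unfolded linear_operator_def]
  show "g \<in> X \<Longrightarrow> T (\<lambda>x. f x + g x) = T f + T g"
    by (rule T[THEN conjunct1, rule_format, OF assms(2)])
  show "g \<in> X \<Longrightarrow> AE x in M. f x = g x \<Longrightarrow> T f = T g"
    by (rule T[THEN conjunct2, THEN conjunct1, rule_format, OF assms(2)])
  show "T (\<lambda>x. c * f x) = sc c (T f)"
    by (rule T[THEN conjunct2, THEN conjunct2, rule_format, OF assms(2)])
qed

lemma operator_scaleR:
  assumes "banach_scaling sc" "linear_operator M X sc T" "f \<in> X"
  shows "T (\<lambda>x. of_real r * f x) = r *\<^sub>R T f"
  using linear_operator_scale[OF assms(2,3)] assms(1) by (simp add: banach_scaling_def)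

lemma operator_zero:
  assumes "banach_scaling sc" "linear_operator M X sc T"
  shows "T (\<lambda>x. 0) = 0"
  using operator_scaleR[OF assms zero_mem, of 0] by simp

lemma operator_sum:
  assumes "banach_scaling sc" "linear_operator M X sc T"
    and "finite I" "\<And>i. i \<in> I \<Longrightarrow> h i \<in> X"
  shows "T (\<lambda>x. \<Sum>i\<in>I. h i x) = (\<Sum>i\<in>I. T (h i))"
  using assms(3,4)
proof (induction I rule: finite_induct)
  case empty
  then show ?case using operator_zero[OF assms(1,2)] by simp
next
  case (insert i I)
  have "T (\<lambda>x. h i x + (\<Sum>i\<in>I. h i x)) = T (h i) + T (\<lambda>x. \<Sum>i\<in>I. h i x)"
    using insert by (intro linear_operator_add[OF assms(2)] sum_mem) auto
  with insert show ?case by simp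
qed

lemma compact_operator_bounded:
  assumes "banach_scaling sc" "compact_operator M X N sc T"
  obtains B where "0 < B" "\<And>f. f \<in> X \<Longrightarrow> norm (T f) \<le> B * N f"
proof -
  have lin: "linear_operator M X sc T" and "compact (closure (T ` {f \<in> X. N f \<le> 1}))"
    using assms(2) by (auto simp: compact_operator_def)
  then have "bounded (T ` {f \<in> X. N f \<le> 1})"
    using compact_imp_bounded bounded_subset closure_subset by blast
  then obtain B where B: "0 < B" "\<And>f. f \<in> X \<Longrightarrow> N f \<le> 1 \<Longrightarrow> norm (T f) \<le> B"
    unfolding bounded_pos by auto
  have "norm (T f) \<le> B * N f" if f: "f \<in> X" for f
  \<comment> \<open>A function of norm 0 cannot be normalised; it is zero a.e., and \<open>T\<close>
    respects a.e. equality. Otherwise homogeneity reduces the claim to the unit ball, whose image is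
    bounded.\<close>
  proof (cases "N f = 0")
    case True
    then have "AE x in M. f x = 0" using norm_eq_0 f by simp
    then have "T f = T (\<lambda>x. 0)" by (rule linear_operator_cong_AE[OF lin f zero_mem])
    then show ?thesis using operator_zero[OF assms(1) lin] True by simp
  next
    case False
    then have pos: "0 < N f" using norm_nonneg[OF f] by simp
    let ?g = "\<lambda>x. of_real (1 / N f) * f x"
    have "N ?g \<le> 1"
      using norm_scale_of_real[OF f, of "1 / N f"] pos by simp
    then have "norm (T ?g) \<le> B" by (intro B(2) scale_mem f)
    then have "norm ((1 / N f) *\<^sub>R T f) \<le> B"
      by (simp only: operator_scaleR[OF assms(1) lin f])
    then show ?thesis using pos by (simp add: divide_simps)
  qed
  with B(1) that show thesis by blast
qed

end

section \<open>Selection of indices and of witnesses\<close>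

lemma exists_finite_pairwise_choice:
  fixes P :: "nat \<Rightarrow> nat \<Rightarrow> bool"
  assumes "eventually Q sequentially" "\<And>m. eventually (P m) sequentially"
  shows "\<exists>s. (\<forall>j\<in>{1..K::nat}. Q (s j)) \<and> (\<forall>j\<in>{1..K}. \<forall>k\<in>{1..K}. j < k \<longrightarrow> P (s j) (s k))"
proof (induction K)
  case 0
  then show ?case by simp
next
  case (Suc K)
  then obtain s where s: "\<forall>j\<in>{1..K}. Q (s j)"
    "\<forall>j\<in>{1..K}. \<forall>k\<in>{1..K}. j < k \<longrightarrow> P (s j) (s k)" by blast
  \<comment> \<open>Only finitely many earlier choices constrain the next one, so some late
    \<open>n\<close> meets all the constraints.\<close>
  have ev: "\<forall>\<^sub>F n in sequentially. Q n \<and> (\<forall>j\<in>{1..K}. P (s j) n)"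
    using assms by (intro eventually_conj eventually_ball_finite) auto
  then obtain n where n: "Q n" "\<forall>j\<in>{1..K}. P (s j) n"
    using eventually_happens'[OF sequentially_bot ev] by blast
  show ?case
  proof (intro exI[of _ "s(Suc K := n)"] conjI ballI impI)
    fix j assume "j \<in> {1..Suc K}"
    then show "Q ((s(Suc K := n)) j)" using s n by (cases "j = Suc K") auto
  next
    fix j k assume "j \<in> {1..Suc K}" "k \<in> {1..Suc K}" "j < k"
    then show "P ((s(Suc K := n)) j) ((s(Suc K := n)) k)"
      using s n by (cases "k = Suc K") auto
  qed
qed

lemma limsup_SUP_norm_nonzero_witnesses:
  assumes F: "\<And>i. F i \<noteq> {}" and L: "limsup (\<lambda>i. SUP f\<in>F i. ereal (norm (T f))) \<noteq> 0"
  obtains e p g where "0 < e" "strict_mono (p :: nat \<Rightarrow> nat)" "\<And>i. g i \<in> F i"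
    "\<And>k. e < norm (T (g (p k)))"
proof -
  let ?S = "\<lambda>i. SUP f\<in>F i. ereal (norm (T f))"
  \<comment> \<open>Nonemptiness of \<open>F i\<close> matters here: the supremum over the empty set
    would be minus infinity. With it, a nonzero limsup is positive.\<close>
  have "0 \<le> ?S i" for i
  proof -
    obtain f where "f \<in> F i" using F by blast
    then show ?thesis by (rule SUP_upper2) simp
  qed
  then have "0 \<le> limsup ?S" by (intro le_Limsup) (auto intro!: always_eventually)
  with L have "0 < limsup ?S" by simp
  then obtain e where e: "0 < ereal e" "ereal e < limsup ?S"
    using ereal_dense2 by blast
  let ?A = "{i. ereal e < ?S i}"
  have "\<not> eventually (\<lambda>i. ?S i \<le> ereal e) sequentially"
    using Limsup_bounded[where F = sequentially and X = ?S and C = "ereal e"] e by auto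
  then have "infinite ?A"
    unfolding cofinite_eq_sequentially[symmetric] eventually_cofinite not_le .
  \<comment> \<open>A member is chosen for every \<open>i\<close>, not only for \<open>i\<close> in
    \<open>?A\<close>, because conditions (1) and (2) speak of full sequences; \<open>p\<close> will
    enumerate \<open>?A\<close>.\<close>
  define g where "g i = (SOME f. f \<in> F i \<and> (i \<in> ?A \<longrightarrow> e < norm (T f)))" for i
  have g: "g i \<in> F i \<and> (i \<in> ?A \<longrightarrow> e < norm (T (g i)))" for i
    unfolding g_def by (rule someI_ex) (use F[of i] in \<open>auto simp: less_SUP_iff ex_in_conv\<close>)
  show thesis
  proof
    show "strict_mono (enumerate ?A)"
      using \<open>infinite ?A\<close> by (rule strict_mono_enumerate)
    show "e < norm (T (g (enumerate ?A k)))" for k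
      using g enumerate_in_set[OF \<open>infinite ?A\<close>] by blast
  qed (use e g in auto)
qed

section \<open>The contradiction under either condition\<close>

theorem theorem4p2:
  fixes M :: "'a measure"
    and X :: "('a \<Rightarrow> 'k::{real_normed_field, euclidean_space}) set"
    and N :: "('a \<Rightarrow> 'k) \<Rightarrow> real"
    and \<phi> :: "nat \<Rightarrow> real"
    and F :: "nat \<Rightarrow> ('a \<Rightarrow> 'k) set"
  assumes "banach_function_space M X N"
    and "\<And>K. 1 \<le> K \<Longrightarrow> 0 \<le> \<phi> K"
    and "(\<lambda>K. \<phi> K / real K) \<longlonglongrightarrow> 0"
    and "\<And>(n::nat) (f :: nat \<Rightarrow> 'a \<Rightarrow> 'k).
           \<lbrakk>1 \<le> n; \<And>j. j \<in> {1..n} \<Longrightarrow> f j \<in> X;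
            \<And>j k. \<lbrakk>j \<in> {1..n}; k \<in> {1..n}; j \<noteq> k\<rbrakk> \<Longrightarrow> disjointly_supported M (f j) (f k);
            (MAX j\<in>{1..n}. N (f j)) \<le> 1\<rbrakk>
           \<Longrightarrow> N (\<lambda>x. of_real (MAX j\<in>{1..n}. norm (f j x))) \<le> \<phi> n"
    and "\<And>i. F i \<noteq> {}"
    and "\<And>i. F i \<subseteq> X"
    and "(SUP i. SUP f\<in>F i. ereal (N f)) < \<infinity>"
  shows "((\<forall>f \<in> (\<Union>i. F i). \<forall>g. (\<forall>i. g i \<in> F i) \<longrightarrow>
             (\<lambda>i. N (\<lambda>x. indicator (supp M f) x * g i x)) \<longlonglongrightarrow> 0)
           \<longrightarrow> admissible_testing_compactness M X N F TYPE('y::banach)) \<and>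
         ((\<forall>f \<in> (\<Union>i. F i). \<forall>g. (\<forall>i. g i \<in> F i) \<longrightarrow>
             (\<lambda>i. N (\<lambda>x. indicator (supp M (g i)) x * f x)) \<longlonglongrightarrow> 0)
           \<longrightarrow> admissible_testing_compactness M X N F TYPE('y))"
proof -
  interpret banach_function_space M X N by fact
  obtain c where c: "(SUP i. SUP f\<in>F i. ereal (N f)) < ereal c"
    using assms(7) ereal_dense2 by blast
  \<comment> \<open>The maximum with 1 makes division by \<open>C\<close> possible.\<close>
  define C where "C = max 1 c"
  have C: "0 < C" by (simp add: C_def)
  have NC: "N f \<le> C" if "f \<in> F i" for f i
  proof -
    have "ereal (N f) \<le> (SUP f\<in>F i. ereal (N f))"
      using that by (intro SUP_upper)
    also have "\<dots> \<le> (SUP i. SUP f\<in>F i. ereal (N f))"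
      by (intro SUP_upper) auto
    also note c
    finally show ?thesis by (simp add: C_def)
  qed
  \<comment> \<open>The Boolean \<open>asc\<close> treats both conditions at once:
    \<open>True\<close> is condition (1), \<open>False\<close> is condition (2).\<close>
  have key: "admissible_testing_compactness M X N F TYPE('y)"
    if lim: "\<And>f g. \<lbrakk>f \<in> (\<Union>i. F i); \<forall>i. g i \<in> F i\<rbrakk> \<Longrightarrow>
      (\<lambda>i. N (\<lambda>x. indicator (supp M (if asc then f else g i)) x * (if asc then g i else f) x))
        \<longlonglongrightarrow> 0"
    for asc
    unfolding admissible_testing_compactness_def
  proof (intro allI impI, rule ccontr)
    fix sc :: "'k \<Rightarrow> 'y \<Rightarrow> 'y" and T
    assume sc: "banach_scaling sc" and T: "compact_operator M X N sc T"
      and L: "limsup (\<lambda>i. SUP f\<in>F i. ereal (norm (T f))) \<noteq> 0"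
    obtain e g and p :: "nat \<Rightarrow> nat" where e: "0 < e" and p: "strict_mono p"
      and g: "\<And>i. g i \<in> F i" and ge: "\<And>k. e < norm (T (g (p k)))"
      by (rule limsup_SUP_norm_nonzero_witnesses[where F = F and T = T, OF assms(5) L]) (rule that)
    have lin: "linear_operator M X sc T" and cpt: "compact (closure (T ` {f \<in> X. N f \<le> 1}))"
      using T by (auto simp: compact_operator_def)
    obtain B where B: "0 < B" "\<And>f. f \<in> X \<Longrightarrow> norm (T f) \<le> B * N f"
      using compact_operator_bounded[OF sc T] by blast
    have gX: "g i \<in> X" for i using g assms(6) by blast
    \<comment> \<open>Compactness concerns the image of the unit ball, so the sequence is scaled
      into it before a convergent subsequence is extracted, and scaled back afterwards.\<close>
    have "(1 / C) *\<^sub>R T (g i) \<in> T ` {f \<in> X. N f \<le> 1}" for i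
    proof -
      have "N (\<lambda>x. of_real (1 / C) * g i x) \<le> 1"
        using gX NC[OF g] C by (subst norm_scale_of_real) auto
      then show ?thesis
        using operator_scaleR[OF sc lin gX, symmetric] scale_mem[OF gX] by blast
    qed
    then have "\<forall>k. (1 / C) *\<^sub>R T (g (p k)) \<in> closure (T ` {f \<in> X. N f \<le> 1})"
      using closure_subset by blast
    then obtain z r where r: "strict_mono (r :: nat \<Rightarrow> nat)"
      and "((\<lambda>k. (1 / C) *\<^sub>R T (g (p k))) \<circ> r) \<longlonglongrightarrow> z"
      using seq_compactE[OF cpt[unfolded compact_eq_seq_compact_metric]] by metis
    then have "(\<lambda>k. C *\<^sub>R ((1 / C) *\<^sub>R T (g (p (r k))))) \<longlonglongrightarrow> C *\<^sub>R z"
      unfolding comp_def by (intro tendsto_intros)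
    then obtain y where y: "(\<lambda>k. T (g (p (r k)))) \<longlonglongrightarrow> y" using C by auto
    define u where "u k = g (p (r k))" for k
    have u: "u k \<in> X" "N (u k) \<le> C" for k using gX NC[OF g] by (auto simp: u_def)
    have "(\<lambda>k. norm (T (u k))) \<longlonglongrightarrow> norm y"
      using y unfolding u_def by (rule tendsto_norm)
    then have ye: "e \<le> norm y"
      by (rule tendsto_lowerbound) (auto simp: u_def intro!: less_imp_le[OF ge] always_eventually)
    \<comment> \<open>This carries the limit assumption \<open>lim\<close> from the full sequence
      \<open>g\<close> over to the subsequence \<open>u\<close>.\<close>
    have sub: "filterlim (\<lambda>k. p (r k)) sequentially sequentially"
      using filterlim_subseq[OF strict_mono_o[OF p r]] by (simp add: comp_def)
    \<comment> \<open>The number \<open>K\<close> of summands is fixed first, and the tolerance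
      \<open>d\<close> depends on it. In the bound for \<open>B * N ?f\<close>, the main term
      becomes less than \<open>real K * (e / 4)\<close> and the error term equals
      \<open>real K * (e / 4)\<close>.\<close>
    have "(\<lambda>K. B * C * (\<phi> K / real K)) \<longlonglongrightarrow> B * C * 0"
      using assms(3) by (intro tendsto_intros)
    from order_tendstoD(2)[OF this, of "e / 4"] e
    have ev: "\<forall>\<^sub>F K in sequentially. B * C * (\<phi> K / real K) < e / 4 \<and> 1 \<le> K"
      by (intro eventually_conj eventually_ge_at_top) simp
    obtain K where K: "B * C * (\<phi> K / real K) < e / 4" "1 \<le> K"
      using eventually_happens'[OF sequentially_bot ev] by blast
    define d where "d = e / (4 * B * real K)"
    have d: "0 < d" using e B K by (simp add: d_def)
    \<comment> \<open>Here \<open>m\<close> is the earlier, fixed index and \<open>n\<close> the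
      later one. The small overlap is a piece of the later function if \<open>asc\<close> holds, and
      of the earlier one otherwise.\<close>
    define P where "P m n \<longleftrightarrow> N (\<lambda>x. indicator (supp M (if asc then u m else u n)) x *
      (if asc then u n else u m) x) \<le> d" for m n
    have P: "eventually (P m) sequentially" for m
    proof -
      have "u m \<in> (\<Union>i. F i)" using g by (auto simp: u_def)
      from filterlim_compose[OF lim[OF this allI[OF g]] sub] have
        "(\<lambda>k. N (\<lambda>x. indicator (supp M (if asc then u m else u k)) x *
          (if asc then u k else u m) x)) \<longlonglongrightarrow> 0"
        by (simp only: u_def)
      from order_tendstoD(2)[OF this d] show ?thesis
        unfolding P_def by (rule eventually_mono) (rule less_imp_le)
    qed
    have "\<forall>\<^sub>F k in sequentially. dist (T (u k)) y < e / 2"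
      using tendstoD[OF y, of "e / 2"] e by (simp add: u_def)
    from exists_finite_pairwise_choice[where P = P and K = K, OF this P] obtain s where
      close: "\<And>j. j \<in> {1..K} \<Longrightarrow> dist (T (u (s j))) y < e / 2"
      and Ps: "\<And>j k. \<lbrakk>j \<in> {1..K}; k \<in> {1..K}; j < k\<rbrakk> \<Longrightarrow> P (s j) (s k)"
      by metis
    \<comment> \<open>The choice of \<open>s\<close> is always increasing in time; for condition (2)
      the roles of \<open>j\<close> and \<open>k\<close> are exchanged, so the relation becomes
      \<open>k < j\<close>.\<close>
    have small: "N (\<lambda>x. indicator (supp M (u (s j))) x * u (s k) x) \<le> d"
      if "j \<in> {1..K}" "k \<in> {1..K}" "if asc then j < k else k < j" for j k
      using Ps[of j k] Ps[of k j] that by (cases asc) (simp_all add: P_def)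
    let ?f = "\<lambda>x. \<Sum>j\<in>{1..K}. u (s j) x"
    have "N ?f \<le> C * \<phi> K + real K * real K * d"
    proof (rule almost_disjoint_sum_norm_le)
      show "(if asc then j < k else k < j) \<or> (if asc then k < j else j < k)"
        if "j \<noteq> k" for j k :: nat
        using that by auto
      show "u (s j) \<in> X" "N (u (s j)) \<le> C" for j by (fact u)+
    qed (fact assms(4) K(2) C less_imp_le[OF d] small)+
    then have "B * N ?f \<le> B * (C * \<phi> K + real K * real K * d)"
      using B by simp
    also have "\<dots> = real K * (B * C * (\<phi> K / real K) + e / 4)"
      using K B by (simp add: d_def field_simps)
    also have "\<dots> < real K * (e / 2)"
    proof (rule mult_strict_left_mono)
      show "B * C * (\<phi> K / real K) + e / 4 < e / 2" using K(1) by linarith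
    qed (use K(2) in simp)
    finally have "B * N ?f < real K * (e / 2)" .
    moreover have "norm (T ?f) \<le> B * N ?f" by (intro B(2) sum_mem u) simp
    ultimately have 1: "norm (T ?f) < real K * (e / 2)" by linarith
    \<comment> \<open>The image of the sum is within \<open>real K * (e / 2)\<close> of
      \<open>real K *\<^sub>R y\<close>, whose norm is at least \<open>real K * e\<close>; this is
      incompatible with the strict bound on \<open>norm (T ?f)\<close>.\<close>
    have "T ?f - real K *\<^sub>R y = (\<Sum>j\<in>{1..K}. T (u (s j)) - y)"
      by (simp add: operator_sum[OF sc lin] u sum_subtractf sum_constant_scaleR)
    also have "norm \<dots> \<le> real (card {1..K}) * (e / 2)"
      using close by (intro sum_norm_bound) (auto simp: dist_norm intro: less_imp_le)
    finally have "norm (T ?f - real K *\<^sub>R y) \<le> real K * (e / 2)" by simp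
    moreover have "real K * norm y \<le> norm (T ?f) + norm (T ?f - real K *\<^sub>R y)"
      using norm_triangle_sub[of "real K *\<^sub>R y" "T ?f"] by (simp add: norm_minus_commute)
    moreover have "real K * e \<le> real K * norm y" using ye by (intro mult_left_mono) auto
    ultimately show False using 1 by (simp add: field_simps)
  qed
  show ?thesis
  proof (intro conjI impI, goal_cases)
    case 1
    show ?case by (rule key[of True]) (use 1 in \<open>simp only: if_True; blast\<close>)
  next
    case 2
    show ?case by (rule key[of False]) (use 2 in \<open>simp only: if_False; blast\<close>)
  qed
qed

end
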